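(* Let $v$ be a positive integer. If a completely quasi-uniform nested $\mathrm{SQS}(v)$ exists, then $v \equiv 4 \pmod{6}$ and the multiplicity of each pair is either $\frac{v-4}{6}$ or $\frac{v+2}{6}$. More precisely, in a completely quasi-uniform nested $\mathrm{SQS}(v)$ there are exactly $\frac{v(v-1)}{3}$ pairs with multiplicity $\frac{v-4}{6}$ and exactly $\frac{v(v-1)}{6}$ pairs with multiplicity $\frac{v+2}{6}$.
   Context: A Steiner quadruple system $\mathrm{SQS}(v)$ is a pair $(V,\mathcal{B})$ where $V$ is a set of $v$ points and $\mathcal{B}$ is a collection of $4$-subsets of $V$ (blocks) such that every $3$-subset of $V$ lies in exactly one block; it is known that an $\mathrm{SQS}(v)$ exists if and only if $v \equiv 2$ or $4 \pmod 6$. A nested $\mathrm{SQS}(v)$ is a pair $(V,\mathscr{B})$ where $\mathscr{B}$ is a set of unordered pairs $\{\{x,y\},\{z,w\}\}$ of $2$-subsets of $V$ (written $\{x,y\mid z,w\}$, called nested blocks) such that $(V,\mathcal{B})$ with $\mathcal{B}=\{\{x,y,z,w\} : \{x,y\mid z,w\}\in\mathscr{B}\}$ is an $\mathrm{SQS}(v)$; i.e. each block of an SQS is partitioned into two pairs (nested pairs). The multiplicity of a pair $\{x,y\}\in\binom{V}{2}$ is the number of nested blocks in $\mathscr{B}$ having $\{x,y\}$ as one of its two pairs. A nested SQS is quasi-uniform if the multiplicities of the nested pairs (pairs with positive multiplicity) are not all equal but any two of them differ by at most one; it is completely quasi-uniform if moreover every pair in $\binom{V}{2}$ has positive multiplicity.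 *)

theory Defs
  imports Complex_Main "HOL-Library.Ramsey" "HOL-Number_Theory.Cong"
begin

text \<open>The library notation \<^term>\<open>[V]\<^bsup>k\<^esup>\<close> stands for the set of all \<open>k\<close>-subsets of \<open>V\<close>.\<close>

definition steiner_quadruple_system :: "nat \<Rightarrow> 'a set \<Rightarrow> 'a set set \<Rightarrow> bool" where
  "steiner_quadruple_system v V B \<longleftrightarrow>
     finite V \<and> card V = v \<and> B \<subseteq> [V]\<^bsup>4\<^esup> \<and>
     (\<forall>T \<in> [V]\<^bsup>3\<^esup>. \<exists>!b. b \<in> B \<and> T \<subseteq> b)"

text \<open>
  A nested block \<open>{x,y | z,w}\<close> is the set \<open>{{x,y}, {z,w}}\<close>, and its underlying block is the
  union \<open>{x,y,z,w}\<close>. That the two pairs are disjoint follows from the underlying block being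
  a 4-set. Injectivity of the union says that each block is partitioned into two pairs in
  exactly one way, so that nested blocks and blocks correspond one to one.
\<close>

definition nested_sqs :: "nat \<Rightarrow> 'a set \<Rightarrow> 'a set set set \<Rightarrow> bool" where
  "nested_sqs v V N \<longleftrightarrow>
     (\<forall>P \<in> N. \<exists>e \<in> [V]\<^bsup>2\<^esup>. \<exists>f \<in> [V]\<^bsup>2\<^esup>. P = {e, f}) \<and>
     inj_on \<Union> N \<and>
     steiner_quadruple_system v V (\<Union> ` N)"

definition multiplicity_of_pair :: "'a set set set \<Rightarrow> 'a set \<Rightarrow> nat" where
  "multiplicity_of_pair N e = card {P \<in> N. e \<in> P}"

definition nested_pairs :: "'a set \<Rightarrow> 'a set set set \<Rightarrow> 'a set set" where
  "nested_pairs V N = {e \<in> [V]\<^bsup>2\<^esup>. multiplicity_of_pair N e > 0}"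

definition quasi_uniform :: "nat \<Rightarrow> 'a set \<Rightarrow> 'a set set set \<Rightarrow> bool" where
  "quasi_uniform v V N \<longleftrightarrow>
     nested_sqs v V N \<and>
     \<not> (\<forall>e \<in> nested_pairs V N. \<forall>f \<in> nested_pairs V N.
          multiplicity_of_pair N e = multiplicity_of_pair N f) \<and>
     (\<forall>e \<in> nested_pairs V N. \<forall>f \<in> nested_pairs V N.
          \<bar>int (multiplicity_of_pair N e) - int (multiplicity_of_pair N f)\<bar> \<le> 1)"

definition completely_quasi_uniform :: "nat \<Rightarrow> 'a set \<Rightarrow> 'a set set set \<Rightarrow> bool" where
  "completely_quasi_uniform v V N \<longleftrightarrow>
     quasi_uniform v V N \<and> (\<forall>e \<in> [V]\<^bsup>2\<^esup>. multiplicity_of_pair N e > 0)"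

end

theory Submission
  imports Defs
begin

text \<open>
  The block counts of a \<open>t\<close>-design give an SQS on \<open>v\<close> points \<open>v(v-1)(v-2)/24\<close> blocks and force \<open>v\<close> to
  be \<open>2\<close> or \<open>4\<close> modulo \<open>6\<close>. Each block contributes two nested pairs, so over all pairs the
  multiplicity averages to \<open>(v-2)/6\<close>. If exactly the multiplicities \<open>m\<close> and \<open>m+1\<close> occur, this average
  lies strictly between them, which leaves only \<open>v = 6m+4\<close>; the average is then \<open>m + 1/3\<close>, so one third
  of the pairs attain the larger multiplicity.
\<close>

lemma choose_two_times_2: "2 * (n choose 2) = n * (n - 1)"
  using binomial_absorption[of 1 n] by (simp add: numeral_2_eq_2)

lemma choose_three_times_3: "3 * (n choose 3) = (n - 2) * (n choose 2)"
  using binomial_absorption[of 2 n] binomial_absorb_comp[of n 2] by simp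

lemma card_nsets_superset:
  assumes "finite X" "S \<subseteq> X" "card S \<le> k"
  shows "card {T \<in> [X]\<^bsup>k\<^esup>. S \<subseteq> T} = (card X - card S) choose (k - card S)"
proof -
  have "finite S" using assms(1,2) by (rule rev_finite_subset)
  have "bij_betw (\<lambda>U. U \<union> S) ([X - S]\<^bsup>(k - card S)\<^esup>) {T \<in> [X]\<^bsup>k\<^esup>. S \<subseteq> T}"
  proof (rule bij_betw_byWitness[where f' = "\<lambda>T. T - S"])
    show "(\<lambda>U. U \<union> S) ` ([X - S]\<^bsup>(k - card S)\<^esup>) \<subseteq> {T \<in> [X]\<^bsup>k\<^esup>. S \<subseteq> T}"
    proof
      fix T assume "T \<in> (\<lambda>U. U \<union> S) ` ([X - S]\<^bsup>(k - card S)\<^esup>)"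
      then obtain U where U: "T = U \<union> S" "U \<subseteq> X - S" "finite U" "card U = k - card S"
        by (auto simp: nsets_def)
      moreover have "card (U \<union> S) = card U + card S"
        using U(2,3) \<open>finite S\<close> by (intro card_Un_disjoint) auto
      ultimately show "T \<in> {T \<in> [X]\<^bsup>k\<^esup>. S \<subseteq> T}"
        using assms(2,3) \<open>finite S\<close> by (auto simp: nsets_def)
    qed
    show "(\<lambda>T. T - S) ` {T \<in> [X]\<^bsup>k\<^esup>. S \<subseteq> T} \<subseteq> [X - S]\<^bsup>(k - card S)\<^esup>"
      using \<open>finite S\<close> by (auto simp: nsets_def card_Diff_subset)
  qed (auto simp: nsets_def)
  then have "card {T \<in> [X]\<^bsup>k\<^esup>. S \<subseteq> T} = card ([X - S]\<^bsup>(k - card S)\<^esup>)"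
    by (rule bij_betw_same_card[symmetric])
  also have "\<dots> = (card X - card S) choose (k - card S)"
    using assms(2) \<open>finite S\<close> by (simp add: card_Diff_subset)
  finally show ?thesis .
qed

definition t_design :: "nat \<Rightarrow> nat \<Rightarrow> nat \<Rightarrow> 'a set \<Rightarrow> 'a set set \<Rightarrow> bool" where
  "t_design t k l V B \<longleftrightarrow>
     finite V \<and> B \<subseteq> [V]\<^bsup>k\<^esup> \<and> (\<forall>T \<in> [V]\<^bsup>t\<^esup>. card {b \<in> B. T \<subseteq> b} = l)"

lemma t_designD:
  assumes "t_design t k l V B"
  shows "finite V" "B \<subseteq> [V]\<^bsup>k\<^esup>" "\<And>T. T \<in> [V]\<^bsup>t\<^esup> \<Longrightarrow> card {b \<in> B. T \<subseteq> b} = l"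
  using assms by (simp_all add: t_design_def)

lemma t_design_card_blocks_superset:
  assumes design: "t_design t k l V B" and "S \<subseteq> V" "card S \<le> t"
  shows "card {b \<in> B. S \<subseteq> b} * ((k - card S) choose (t - card S))
    = l * ((card V - card S) choose (t - card S))"
proof -
  let ?T = "{T \<in> [V]\<^bsup>t\<^esup>. S \<subseteq> T}" and ?C = "{b \<in> B. S \<subseteq> b}"
  have fin: "finite ?T" "finite ?C"
    using t_designD(1,2)[OF design] by (auto simp: finite_imp_finite_nsets intro: finite_subset)
  have "(\<Sum>T\<in>?T. card {b \<in> ?C. T \<subseteq> b}) = ((k - card S) choose (t - card S)) * card ?C"
  proof (rule sum_multicount[OF fin], intro ballI)
    fix b assume b: "b \<in> ?C"
    then have b_nset: "b \<in> [V]\<^bsup>k\<^esup>" using t_designD(2)[OF design] by blast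
    then have "{T \<in> ?T. T \<subseteq> b} = {T \<in> [b]\<^bsup>t\<^esup>. S \<subseteq> T}" by (auto simp: nsets_def)
    then show "card {T \<in> ?T. T \<subseteq> b} = (k - card S) choose (t - card S)"
      using card_nsets_superset[of b S t] b b_nset assms(3) by (simp add: nsets_def)
  qed
  moreover have "card {b \<in> ?C. T \<subseteq> b} = l" if "T \<in> ?T" for T
  proof -
    have "{b \<in> ?C. T \<subseteq> b} = {b \<in> B. T \<subseteq> b}" using that by blast
    then show ?thesis using t_designD(3)[OF design] that by simp
  qed
  ultimately show ?thesis
    using card_nsets_superset[OF t_designD(1)[OF design] assms(2,3)] by (simp add: mult.commute)
qed

lemma t_design_card_blocks:
  assumes "t_design t k l V B"
  shows "card B * (k choose t) = l * (card V choose t)"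
  using t_design_card_blocks_superset[OF assms, of "{}"] by simp

lemma t_design_divisibility:
  assumes "t_design t k l V B" "s \<le> t" "s \<le> card V"
  shows "((k - s) choose (t - s)) dvd l * ((card V - s) choose (t - s))"
proof -
  obtain S where "S \<subseteq> V" "card S = s"
    using obtain_subset_with_card_n[OF assms(3)] by blast
  then show ?thesis
    using t_design_card_blocks_superset[OF assms(1), of S] assms(2) by (metis dvd_triv_right)
qed

lemma steiner_quadruple_system_iff_t_design:
  "steiner_quadruple_system v V B \<longleftrightarrow> card V = v \<and> t_design 3 4 1 V B"
proof -
  have "(\<exists>!b. b \<in> B \<and> T \<subseteq> b) \<longleftrightarrow> card {b \<in> B. T \<subseteq> b} = 1" for T
    by (simp add: is_singleton_iff_ex1 is_singleton_altdef[symmetric] del: One_nat_def)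
  then show ?thesis
    by (auto simp: steiner_quadruple_system_def t_design_def)
qed

lemma steiner_quadruple_system_order_mod_6:
  assumes "steiner_quadruple_system v V B" "2 \<le> v"
  shows "v mod 6 = 2 \<or> v mod 6 = 4"
proof -
  have design: "t_design 3 4 1 V B" and v: "card V = v"
    using assms(1) by (simp_all add: steiner_quadruple_system_iff_t_design)
  have "even (v - 2)"
    using t_design_divisibility[OF design, of 2] assms(2) by (simp add: v)
  then have "even v"
    using assms(2) by simp
  have "3 dvd (v - 1 choose 2)"
    using t_design_divisibility[OF design, of 1] assms(2) by (simp add: v numeral_eq_Suc)
  then have "3 dvd (v - 1) * (v - 2)"
    using choose_two_times_2[of "v - 1"] by (metis diff_diff_left dvd_mult one_add_one)
  then have "3 dvd v - 1 \<or> 3 dvd v - 2"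
    by (simp add: prime_dvd_mult_iff)
  then have "\<not> 3 dvd v"
    using assms(2) by presburger
  then show ?thesis
    using \<open>even v\<close> by presburger
qed

lemma sum_multiplicity_of_pair:
  assumes "finite E" "N \<subseteq> [E]\<^bsup>k\<^esup>"
  shows "(\<Sum>e\<in>E. multiplicity_of_pair N e) = k * card N"
  unfolding multiplicity_of_pair_def
proof (rule sum_multicount[OF assms(1) _ ballI])
  show "finite N"
    using assms by (blast intro: finite_imp_finite_nsets finite_subset)
  fix P assume "P \<in> N"
  then have "{e \<in> E. e \<in> P} = P" "card P = k"
    using assms(2) by (auto simp: nsets_def)
  then show "card {e \<in> E. e \<in> P} = k" by simp
qed

lemma nested_sqs_subset_nsets:
  assumes "nested_sqs v V N"
  shows "N \<subseteq> [[V]\<^bsup>2\<^esup>]\<^bsup>2\<^esup>"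
proof
  fix P assume "P \<in> N"
  then have "\<exists>e\<in>[V]\<^bsup>2\<^esup>. \<exists>f\<in>[V]\<^bsup>2\<^esup>. P = {e, f}" and "\<Union> P \<in> [V]\<^bsup>4\<^esup>"
    using assms by (auto simp: nested_sqs_def steiner_quadruple_system_def)
  then obtain e f where ef: "e \<in> [V]\<^bsup>2\<^esup>" "f \<in> [V]\<^bsup>2\<^esup>" "P = {e, f}" and "card (e \<union> f) = 4"
    by (auto simp: nsets_def)
  then have "e \<noteq> f" by (auto simp: nsets_def)
  with ef show "P \<in> [[V]\<^bsup>2\<^esup>]\<^bsup>2\<^esup>" by simp
qed

lemma nested_sqs_average_multiplicity:
  assumes "nested_sqs v V N"
  shows "6 * (\<Sum>e\<in>[V]\<^bsup>2\<^esup>. multiplicity_of_pair N e) = (v - 2) * card ([V]\<^bsup>2\<^esup>)"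
proof -
  have design: "t_design 3 4 1 V (\<Union> ` N)" and v: "card V = v" and "card (\<Union> ` N) = card N"
    using assms by (simp_all add: nested_sqs_def steiner_quadruple_system_iff_t_design card_image)
  then have "4 * card N = v choose 3"
    using t_design_card_blocks[OF design] by (simp add: numeral_eq_Suc)
  moreover have "(\<Sum>e\<in>[V]\<^bsup>2\<^esup>. multiplicity_of_pair N e) = 2 * card N"
    using t_designD(1)[OF design] nested_sqs_subset_nsets[OF assms]
    by (intro sum_multiplicity_of_pair finite_imp_finite_nsets)
  ultimately show ?thesis
    using choose_three_times_3[of v] by (simp add: v)
qed

lemma image_eq_consecutive_values:
  fixes f :: "'a \<Rightarrow> nat"
  assumes "\<not> (\<forall>x\<in>A. \<forall>y\<in>A. f x = f y)"
    and close: "\<And>x y. x \<in> A \<Longrightarrow> y \<in> A \<Longrightarrow> \<bar>int (f x) - int (f y)\<bar> \<le> 1"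
  obtains m where "f ` A = {m, Suc m}"
proof -
  obtain x y where xy: "x \<in> A" "y \<in> A" "f x < f y"
    using assms(1) by (metis linorder_neqE_nat)
  then have y: "f y = Suc (f x)"
    using close[of x y] by linarith
  have "f z \<in> {f x, f y}" if "z \<in> A" for z
    using close[OF that xy(1)] close[OF that xy(2)] y by auto
  then have "f ` A = {f x, f y}"
    using xy(1,2) by blast
  then show thesis
    using y by (intro that[of "f x"]) simp
qed

lemma sum_consecutive_values:
  fixes f :: "'a \<Rightarrow> nat"
  assumes "finite A" "f ` A \<subseteq> {m, Suc m}"
  shows "sum f A = m * card A + card {x \<in> A. f x = Suc m}"
proof -
  have "sum f A = (\<Sum>x\<in>A. m + of_bool (f x = Suc m))"
    using assms(2) by (intro sum.cong) auto
  then show ?thesis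
    using assms(1) by (simp add: sum.distrib Int_def)
qed

lemma card_consecutive_values:
  fixes f :: "'a \<Rightarrow> nat"
  assumes "finite A" "f ` A \<subseteq> {m, Suc m}"
  shows "card {x \<in> A. f x = m} + card {x \<in> A. f x = Suc m} = card A"
proof -
  have "{x \<in> A. f x = m} \<union> {x \<in> A. f x = Suc m} = A"
    using assms(2) by auto
  then show ?thesis
    using assms(1) by (subst card_Un_disjoint[symmetric]) auto
qed

lemma sum_consecutive_values_bounds:
  fixes f :: "'a \<Rightarrow> nat"
  assumes "finite A" "f ` A = {m, Suc m}"
  shows "m * card A < sum f A" "sum f A < Suc m * card A"
proof -
  have "m \<in> f ` A" "Suc m \<in> f ` A"
    by (simp_all add: assms(2))
  then have "0 < card {x \<in> A. f x = m}" "0 < card {x \<in> A. f x = Suc m}"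
    using assms(1) by (auto simp: card_gt_0_iff)
  then show "m * card A < sum f A" "sum f A < Suc m * card A"
    using sum_consecutive_values[of A f m] card_consecutive_values[of A f m] assms by simp_all
qed

lemma nested_sqs_consecutive_multiplicities:
  assumes nested: "nested_sqs v V N"
    and image: "multiplicity_of_pair N ` [V]\<^bsup>2\<^esup> = {m, Suc m}"
  shows "v = 6 * m + 4"
    and "3 * card {e \<in> [V]\<^bsup>2\<^esup>. multiplicity_of_pair N e = m} = 2 * card ([V]\<^bsup>2\<^esup>)"
    and "3 * card {e \<in> [V]\<^bsup>2\<^esup>. multiplicity_of_pair N e = Suc m} = card ([V]\<^bsup>2\<^esup>)"
proof -
  define p where "p = card ([V]\<^bsup>2\<^esup>)"
  define total where "total = (\<Sum>e\<in>[V]\<^bsup>2\<^esup>. multiplicity_of_pair N e)"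
  define low where "low = card {e \<in> [V]\<^bsup>2\<^esup>. multiplicity_of_pair N e = m}"
  define high where "high = card {e \<in> [V]\<^bsup>2\<^esup>. multiplicity_of_pair N e = Suc m}"
  have sqs: "steiner_quadruple_system v V (\<Union> ` N)"
    using nested by (simp add: nested_sqs_def)
  then have fin: "finite ([V]\<^bsup>2\<^esup>)"
    by (simp add: steiner_quadruple_system_def finite_imp_finite_nsets)
  have average: "6 * total = (v - 2) * p"
    using nested unfolding total_def p_def by (rule nested_sqs_average_multiplicity)
  have "m * p < total" "total < Suc m * p"
    unfolding total_def p_def using fin image by (rule sum_consecutive_values_bounds)+
  then have "6 * m * p < (v - 2) * p" "(v - 2) * p < 6 * Suc m * p"
    unfolding average[symmetric] by (simp_all add: algebra_simps)
  then have bounds: "6 * m < v - 2" "v - 2 < 6 * Suc m"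
    by (simp_all only: mult_less_cancel2)
  then have "v mod 6 = 2 \<or> v mod 6 = 4"
    by (intro steiner_quadruple_system_order_mod_6[OF sqs]) simp
  then obtain k where "v = 6 * k + 2 \<or> v = 6 * k + 4"
    by (metis mult_div_mod_eq)
  with bounds show v: "v = 6 * m + 4"
    by auto
  have "total = m * p + high" "low + high = p"
    unfolding total_def p_def low_def high_def
    using fin image by (simp_all only: sum_consecutive_values card_consecutive_values order_refl)
  with average show "3 * low = 2 * p" "3 * high = p"
    by (simp_all add: v algebra_simps)
qed

lemma completely_quasi_uniform_consecutive_multiplicities:
  assumes "completely_quasi_uniform v V N"
  obtains m where "multiplicity_of_pair N ` [V]\<^bsup>2\<^esup> = {m, Suc m}"
proof (rule image_eq_consecutive_values)
  have "nested_pairs V N = [V]\<^bsup>2\<^esup>"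
    using assms by (auto simp: completely_quasi_uniform_def nested_pairs_def)
  then show "\<not> (\<forall>e\<in>[V]\<^bsup>2\<^esup>. \<forall>f\<in>[V]\<^bsup>2\<^esup>. multiplicity_of_pair N e = multiplicity_of_pair N f)"
    and "\<And>e f. e \<in> [V]\<^bsup>2\<^esup> \<Longrightarrow> f \<in> [V]\<^bsup>2\<^esup> \<Longrightarrow>
      \<bar>int (multiplicity_of_pair N e) - int (multiplicity_of_pair N f)\<bar> \<le> 1"
    using assms by (simp_all add: completely_quasi_uniform_def quasi_uniform_def)
qed (rule that)

theorem theorem2p1:
  fixes v :: nat and V :: "'a set" and N :: "'a set set set"
  assumes "v > 0"
    and "completely_quasi_uniform v V N"
  shows "[v = 4] (mod 6)
    \<and> (\<forall>e \<in> [V]\<^bsup>2\<^esup>.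
          real (multiplicity_of_pair N e) = (real v - 4) / 6 \<or>
          real (multiplicity_of_pair N e) = (real v + 2) / 6)
    \<and> real (card {e \<in> [V]\<^bsup>2\<^esup>. real (multiplicity_of_pair N e) = (real v - 4) / 6})
        = real v * (real v - 1) / 3
    \<and> real (card {e \<in> [V]\<^bsup>2\<^esup>. real (multiplicity_of_pair N e) = (real v + 2) / 6})
        = real v * (real v - 1) / 6"
proof -
  have nested: "nested_sqs v V N"
    using assms(2) by (simp add: completely_quasi_uniform_def quasi_uniform_def)
  obtain m where image: "multiplicity_of_pair N ` [V]\<^bsup>2\<^esup> = {m, Suc m}"
    using assms(2) by (rule completely_quasi_uniform_consecutive_multiplicities)
  note counts = nested_sqs_consecutive_multiplicities[OF nested image]
  have low_iff: "real n = (real v - 4) / 6 \<longleftrightarrow> n = m"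
    and high_iff: "real n = (real v + 2) / 6 \<longleftrightarrow> n = Suc m" for n
    by (auto simp: counts(1))
  have "card V = v"
    using nested by (simp add: nested_sqs_def steiner_quadruple_system_def)
  then have "2 * card ([V]\<^bsup>2\<^esup>) = v * (v - 1)"
    by (simp add: choose_two_times_2)
  then have "2 * real (card ([V]\<^bsup>2\<^esup>)) = real v * (real v - 1)"
    using assms(1) by (metis One_nat_def Suc_leI of_nat_1 of_nat_diff of_nat_mult of_nat_numeral)
  moreover have "[v = 4] (mod 6)"
    by (simp add: counts(1) cong_def)
  moreover have "\<forall>e\<in>[V]\<^bsup>2\<^esup>. multiplicity_of_pair N e = m \<or> multiplicity_of_pair N e = Suc m"
    using image by auto
  ultimately show ?thesis
    unfolding low_iff high_iff using counts(2,3) by auto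
qed

end
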